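(* Let $\mathcal{H}$ be a real Hilbert space. Let $f \in \mathcal{F}_{\mu_f, L_f}$, $g \in \mathcal{F}_{\mu_g, L_g}$, and $h \in \mathcal{F}_{\mu_h, L_h}$ be functions on $\mathcal{H}$, where $$0 \le \mu_f < L_f \le \infty, \quad 0 \le \mu_g < L_g \le \infty, \quad 0 \le \mu_h < L_h < \infty.$$ Let $\lambda > 0$ and $\alpha > 0$, and assume additionally that $\lambda < 2 - \frac{\alpha(\mu_h + L_h)}{2}$. Write $$\nu_f = \min\left\{ \frac{2 \mu_f + \mu_h}{(1 + \alpha \mu_f)^2}, \frac{2 L_f + \mu_h}{(1 + \alpha L_f)^2} \right\},\quad \nu_g = \min\left\{ \frac{2 \mu_g + \mu_h}{(1 + \alpha \mu_g)^2}, \frac{2 L_g + \mu_h}{(1 + \alpha L_g)^2} \right\},\quad \theta = \frac{2}{4 - \alpha(\mu_h + L_h)},$$ where the second entry of the minimum is taken to be $0$ when $L_f = \infty$ (resp. $L_g = \infty$), so that $\nu_f = 0$ when $L_f = \infty$ and $\nu_g = 0$ when $L_g = \infty$. Then the subdifferential Davis--Yin splitting operator $\mathbb{T}_{\partial f, \partial g, \nabla h, \alpha, \lambda}\colon\mathcal{H}\to\mathcal{H}$ is $\rho$-contractive (i.e. Lipschitz with constant $\rho$), where $$\rho = 1 - \lambda \theta + \lambda \sqrt{\left(\theta - \alpha \nu_f \right) \left(\theta - \alpha \nu_g \right)}.$$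
   Context: $\mathcal{H}$ is a real Hilbert space with inner product $\langle\cdot,\cdot\rangle$ and norm $\|\cdot\|$. Functions on $\mathcal{H}$ are extended real-valued, $f\colon\mathcal{H}\to\mathbb{R}\cup\{\pm\infty\}$; $f$ is CCP if it is convex, closed (lower semicontinuous), and proper. For $\mu, L \in (0,\infty)$: $f$ is $\mu$-strongly convex if $f - \frac{\mu}{2}\|\cdot\|^2$ is convex; $f$ is $L$-smooth if it is (finite and) differentiable on $\mathcal{H}$ with $L$-Lipschitz continuous gradient. Function classes, for $\mu, L\in(0,\infty)$: - $\mathcal{F}_{\mu,L}$: all CCP functions that are $\mu$-strongly convex and $L$-smooth; - $\mathcal{F}_{0,L}$: all CCP functions that are $L$-smooth; - $\mathcal{F}_{\mu,\infty}$: all CCP functions that are $\mu$-strongly convex; - $\mathcal{F}_{0,\infty}$: all CCP functions. For a CCP function $f$ and $\alpha>0$, the proximal operator is $\mathrm{Prox}_{\alpha f}(x) = \operatorname{argmin}_{y\in\mathcal{H}}\{\alpha f(y) + \frac12\|x-y\|^2\}$, which equals the resolvent $(\mathbb{I}+\alpha\partial f)^{-1}$, where $\partial f$ is the convex subdifferential and $\mathbb{I}$ is the identity map. For step size $\alpha>0$ and averaging parameter $\lambda>0$, the subdifferential Davis--Yin splitting (DYS) operator is $$\mathbb{T}_{\partial f,\partial g,\nabla h,\alpha,\lambda} = \mathbb{I} - \lambda\,\mathrm{Prox}_{\alpha g} + \lambda\,\mathrm{Prox}_{\alpha f}\,(2\,\mathrm{Prox}_{\alpha g} - \mathbb{I}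 - \alpha\nabla h\,\mathrm{Prox}_{\alpha g}),$$ where juxtaposition of operators denotes composition; that is, $\mathbb{T}x = x - \lambda p + \lambda\,\mathrm{Prox}_{\alpha f}(2p - x - \alpha\nabla h(p))$ with $p=\mathrm{Prox}_{\alpha g}(x)$. An operator $\mathbb{T}\colon\mathcal{H}\to\mathcal{H}$ is called $\rho$-contractive here if $\|\mathbb{T}x-\mathbb{T}y\|\le\rho\|x-y\|$ for all $x,y\in\mathcal{H}$ (the value $\rho=1$ is allowed; it is a strict contraction only when $\rho<1$). *)

theory Defs
  imports "HOL-Analysis.Analysis"
begin

text \<open>Convexity is that of the epigraph, which avoids sums of the form \<open>\<infinity> - \<infinity>\<close>.\<close>

definition convex_ereal :: "('a::real_vector \<Rightarrow> ereal) \<Rightarrow> bool" where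
  "convex_ereal f \<longleftrightarrow> convex {(x, r :: real). f x \<le> ereal r}"

definition lower_semicontinuous :: "('a::topological_space \<Rightarrow> ereal) \<Rightarrow> bool" where
  "lower_semicontinuous f \<longleftrightarrow> (\<forall>x. f x \<le> Liminf (at x) f)"

definition proper :: "('a \<Rightarrow> ereal) \<Rightarrow> bool" where
  "proper f \<longleftrightarrow> (\<forall>x. f x \<noteq> -\<infinity>) \<and> (\<exists>x. f x \<noteq> \<infinity>)"

definition ccp :: "('a::real_inner \<Rightarrow> ereal) \<Rightarrow> bool" where
  "ccp f \<longleftrightarrow> convex_ereal f \<and> lower_semicontinuous f \<and> proper f"

definition strongly_convex :: "real \<Rightarrow> ('a::real_inner \<Rightarrow> ereal) \<Rightarrow> bool" where
  "strongly_convex \<mu> f \<longleftrightarrow> convex_ereal (\<lambda>x. f x - ereal (\<mu> / 2 * (norm x)\<^sup>2))"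

text \<open>The gradient is only meaningful where \<open>f\<close> is finite near \<open>x\<close> and differentiable at \<open>x\<close>.
  In a Hilbert space, Frechet differentiability amounts to the existence of a gradient vector.\<close>

definition grad :: "('a::real_inner \<Rightarrow> ereal) \<Rightarrow> 'a \<Rightarrow> 'a" where
  "grad f x = (THE D. GDERIV (\<lambda>y. real_of_ereal (f y)) x :> D)"

definition smooth :: "real \<Rightarrow> ('a::real_inner \<Rightarrow> ereal) \<Rightarrow> bool" where
  "smooth L f \<longleftrightarrow>
     (\<forall>x. \<bar>f x\<bar> \<noteq> \<infinity>) \<and>
     (\<forall>x. \<exists>D. GDERIV (\<lambda>y. real_of_ereal (f y)) x :> D) \<and>
     L-lipschitz_on UNIV (grad f)"

text \<open>Intended for \<open>0 \<le> \<mu> < \<infinity>\<close> and \<open>0 < L \<le> \<infinity>\<close>: \<open>\<mu> = 0\<close> imposes no strong convexity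
  and \<open>L = \<infinity>\<close> imposes no smoothness.\<close>

definition function_class :: "real \<Rightarrow> ereal \<Rightarrow> ('a::real_inner \<Rightarrow> ereal) set" where
  "function_class \<mu> L =
     {f. ccp f \<and> (\<mu> > 0 \<longrightarrow> strongly_convex \<mu> f) \<and> (L \<noteq> \<infinity> \<longrightarrow> smooth (real_of_ereal L) f)}"

text \<open>For a CCP function on a Hilbert space and \<open>\<alpha> > 0\<close> the minimizer exists and is unique, so the
  choice made by \<^const>\<open>arg_min\<close> is immaterial.\<close>

definition prox :: "real \<Rightarrow> ('a::real_inner \<Rightarrow> ereal) \<Rightarrow> 'a \<Rightarrow> 'a" where
  "prox \<alpha> f x = (ARG_MIN (\<lambda>y. ereal \<alpha> * f y + ereal (1 / 2 * (norm (x - y))\<^sup>2)) y. True)"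

definition dys_operator ::
  "('a::real_inner \<Rightarrow> ereal) \<Rightarrow> ('a \<Rightarrow> ereal) \<Rightarrow> ('a \<Rightarrow> ereal) \<Rightarrow> real \<Rightarrow> real \<Rightarrow> 'a \<Rightarrow> 'a" where
  "dys_operator f g h \<alpha> lam x =
     x - lam *\<^sub>R prox \<alpha> g x
       + lam *\<^sub>R prox \<alpha> f (2 *\<^sub>R prox \<alpha> g x - x - \<alpha> *\<^sub>R grad h (prox \<alpha> g x))"

text \<open>The quantity \<open>\<nu>\<close> of a function in \<open>function_class \<mu> L\<close>, where \<open>\<mu>\<^sub>h\<close> is the strong convexity
  parameter of the smooth term.\<close>

definition dys_nu :: "real \<Rightarrow> real \<Rightarrow> ereal \<Rightarrow> real \<Rightarrow> real" where
  "dys_nu \<alpha> \<mu> L \<mu>\<^sub>h =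
     min ((2 * \<mu> + \<mu>\<^sub>h) / (1 + \<alpha> * \<mu>)\<^sup>2)
         (if L = \<infinity> then 0
          else (2 * real_of_ereal L + \<mu>\<^sub>h) / (1 + \<alpha> * real_of_ereal L)\<^sup>2)"

end

theory Submission
  imports Defs
begin

text \<open>Write \<open>T = (1 - lam \<theta>) I + lam R\<close>, so that it suffices to bound \<open>R\<close>, and put \<open>k = \<alpha> \<mu>\<^sub>h\<close>,
  \<open>d = \<alpha> (L\<^sub>h - \<mu>\<^sub>h)\<close>, \<open>c = 2 - k\<close>, so \<open>1 / \<theta> = c - d / 2\<close>. Cocoercivity of the gradients
  gives \<open>\<alpha> \<nu> \<parallel>z\<parallel>\<^sup>2 \<le> 2 \<langle>z, u\<rangle> - c \<parallel>u\<parallel>\<^sup>2\<close> for differences \<open>z\<close> of arguments and \<open>u\<close> of values of each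
  proximal operator, and places the difference of \<open>\<alpha> \<nabla>h\<close> at \<open>k u + (d / 2) (u + e)\<close> with
  \<open>\<parallel>e\<parallel> \<le> \<parallel>u\<parallel>\<close>. Then the argument of \<open>prox \<alpha> f\<close> differs by \<open>s = u / \<theta> - z - (d / 2) e\<close>, and
  \<open>\<theta> \<parallel>s + (d / 2) e\<parallel>\<^sup>2 + (d / 2) \<parallel>u\<parallel>\<^sup>2\<close> is at most \<open>(\<theta> - \<alpha> \<nu>\<^sub>g) \<parallel>z\<parallel>\<^sup>2\<close>, while
  \<open>\<theta> - \<alpha> \<nu>\<^sub>f\<close> times it bounds \<open>\<parallel>R x - R y\<parallel>\<^sup>2\<close>.\<close>

subsection \<open>Existence and optimality of proximal points\<close>

lemma convex_erealD:
  assumes "convex_ereal f" "f x \<le> ereal r" "f y \<le> ereal s" "0 \<le> t" "t \<le> 1"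
  shows "f ((1 - t) *\<^sub>R x + t *\<^sub>R y) \<le> ereal ((1 - t) * r + t * s)"
proof -
  have "(1 - t) *\<^sub>R (x, r) + t *\<^sub>R (y, s) \<in> {(x, r). f x \<le> ereal r}"
    using assms by (intro convexD) (auto simp: convex_ereal_def)
  then show ?thesis
    by simp
qed

lemma lower_semicontinuous_eventually_greater:
  assumes "lower_semicontinuous f" "c < f x"
  shows "\<forall>\<^sub>F y in nhds x. c < f y"
proof -
  have "c < Liminf (at x) f"
    using assms by (metis lower_semicontinuous_def order_less_le_trans)
  then have "\<forall>\<^sub>F y in at x. c < f y"
    by (rule less_LiminfD)
  then show ?thesis
    using assms(2) by (auto simp: eventually_at_filter elim!: eventually_mono)
qed

text \<open>A level strictly between \<open>s\<close> and \<open>f z\<close> would eventually exceed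
  \<open>r n\<close> and stay below \<open>f (y n)\<close>. This lets a minimizing sequence of
  epigraph points pass to its limit.\<close>

lemma lower_semicontinuous_epigraph_closed:
  assumes "lower_semicontinuous f" "y \<longlonglongrightarrow> z" "r \<longlonglongrightarrow> s"
    and le: "\<And>n. f (y n) \<le> ereal (r n)"
  shows "f z \<le> ereal s"
proof (rule ccontr)
  assume "\<not> f z \<le> ereal s"
  then obtain c where c: "ereal s < ereal c" "ereal c < f z"
    by (metis ereal_dense2 not_le)
  have "\<forall>\<^sub>F n in sequentially. ereal c < f (y n)"
    using eventually_compose_filterlim[OF lower_semicontinuous_eventually_greater[OF assms(1) c(2)] assms(2)] .
  moreover have "\<forall>\<^sub>F n in sequentially. r n < c"
    using c(1) assms(3) by (auto intro: order_tendstoD)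
  ultimately have "\<forall>\<^sub>F n in sequentially. False"
  proof eventually_elim
    case (elim n)
    then show ?case
      using le[of n] by (meson ereal_less_le less_ereal.simps(1) not_le order_less_le_trans order_less_trans)
  qed
  then show False
    by simp
qed

text \<open>Semicontinuity bounds \<open>f\<close> from below on a ball around a point of its domain; convexity along
  rays from that point spreads the bound over the whole space. No separation theorem is needed.\<close>

lemma ccp_lower_bound:
  assumes "ccp f" "f x\<^sub>0 = ereal v"
  obtains K where "0 \<le> K" "\<And>y r. f y \<le> ereal r \<Longrightarrow> v - 1 - K * norm (y - x\<^sub>0) \<le> r"
proof -
  have conv: "convex_ereal f" and lsc: "lower_semicontinuous f"
    using assms by (auto simp: ccp_def)
  have "\<forall>\<^sub>F y in nhds x\<^sub>0. ereal (v - 1) < f y"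
    using lsc by (rule lower_semicontinuous_eventually_greater) (simp add: assms)
  then obtain d where d: "d > 0" "\<And>y. dist y x\<^sub>0 < d \<Longrightarrow> ereal (v - 1) < f y"
    by (auto simp: eventually_nhds_metric)
  have "v - 1 - (2 / d) * norm (y - x\<^sub>0) \<le> r" if le: "f y \<le> ereal r" for y r
  proof (cases "dist y x\<^sub>0 < d")
    case True
    then have "v - 1 < r"
      using d(2)[of y] le by (metis ereal_less_le less_ereal.simps(1) order_less_le_trans)
    moreover have "0 \<le> (2 / d) * norm (y - x\<^sub>0)"
      using d by simp
    ultimately show ?thesis
      by linarith
  next
    case False
    define R where "R = norm (y - x\<^sub>0)"
    \<comment> \<open>This puts the point of the segment at distance \<open>d / 2\<close> from
      \<open>x\<^sub>0\<close>, inside the ball; the slope \<open>2 / d\<close> comes from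
      \<open>1 / t\<close>.\<close>
    define t where "t = d / (2 * R)"
    have R: "R \<ge> d" "R > 0"
      using False d by (auto simp: R_def dist_norm)
    then have t: "0 < t" "t \<le> 1" and tR: "t * R = d / 2"
      using d by (auto simp: t_def field_simps)
    have "dist ((1 - t) *\<^sub>R x\<^sub>0 + t *\<^sub>R y) x\<^sub>0 = norm (t *\<^sub>R (y - x\<^sub>0))"
      by (simp add: dist_norm algebra_simps)
    also have "\<dots> = d / 2"
      using t tR by (simp add: R_def)
    finally have "ereal (v - 1) < f ((1 - t) *\<^sub>R x\<^sub>0 + t *\<^sub>R y)"
      using d by auto
    also have "\<dots> \<le> ereal ((1 - t) * v + t * r)"
      using convex_erealD[OF conv _ le, of x\<^sub>0 v t] t assms(2) by simp
    finally have "t * (v - r) < 1"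
      by (simp add: algebra_simps)
    then have "v - r < 1 / t"
      using t by (simp add: field_simps)
    also have "1 / t = (2 / d) * R"
      using t d by (simp add: t_def)
    finally show ?thesis
      by (simp add: R_def)
  qed
  moreover have "0 \<le> 2 / d"
    using d by simp
  ultimately show thesis
    using that by blast
qed

text \<open>The parallelogram law, with the midpoint in the form that \<open>convex_erealD\<close>
  produces. Its negative term makes minimizing sequences Cauchy.\<close>

lemma norm_diff_midpoint_sq:
  fixes y z :: "'a::real_inner"
  shows "(norm (x - ((1 - 1/2) *\<^sub>R y + (1/2::real) *\<^sub>R z)))\<^sup>2
       = ((norm (x - y))\<^sup>2 + (norm (x - z))\<^sup>2) / 2 - (norm (y - z))\<^sup>2 / 4"
  by (simp add: power2_norm_eq_inner inner_diff_left inner_diff_right inner_add_left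
      inner_add_right inner_commute field_simps)

text \<open>Direct method: strong convexity of the quadratic term makes a minimizing sequence
  Cauchy, completeness supplies a limit, and lower semicontinuity makes it optimal. Minimization
  runs over pairs in the epigraph, so that all costs are real.\<close>

lemma prox_minimizer_exists:
  fixes f :: "'a::{real_inner, complete_space} \<Rightarrow> ereal"
  assumes "ccp f" "\<alpha> > 0"
  obtains p v where "f p = ereal v"
    "\<And>y r. f y \<le> ereal r \<Longrightarrow> \<alpha> * v + (norm (x - p))\<^sup>2 / 2 \<le> \<alpha> * r + (norm (x - y))\<^sup>2 / 2"
proof -
  have conv: "convex_ereal f" and lsc: "lower_semicontinuous f" and proper: "proper f"
    using assms by (auto simp: ccp_def)
  obtain x\<^sub>0 v\<^sub>0 where x0: "f x\<^sub>0 = ereal v\<^sub>0"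
    using proper unfolding proper_def by (metis ereal_cases)
  define q where "q y r = \<alpha> * r + (norm (x - y))\<^sup>2 / 2" for y and r :: real
  define E where "E = {(y, r). f y \<le> ereal r}"
  define m where "m = Inf (case_prod q ` E)"
  obtain K where K: "0 \<le> K" "\<And>y r. f y \<le> ereal r \<Longrightarrow> v\<^sub>0 - 1 - K * norm (y - x\<^sub>0) \<le> r"
    using ccp_lower_bound[OF assms(1) x0] by blast
  \<comment> \<open>The quadratic term outweighs the linear decay allowed by
    \<open>ccp_lower_bound\<close>: complete the square in
    \<open>norm (x - y) - \<alpha> * K\<close>.\<close>
  have bound: "\<alpha> * (v\<^sub>0 - 1 - K * norm (x - x\<^sub>0)) - (\<alpha> * K)\<^sup>2 / 2 \<le> q y r" if "f y \<le> ereal r" for y r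
  proof -
    have "norm (y - x\<^sub>0) \<le> norm (x - y) + norm (x - x\<^sub>0)"
      by (metis norm_minus_commute norm_triangle_sub diff_add_cancel norm_triangle_ineq add_diff_eq)
    then have "v\<^sub>0 - 1 - K * (norm (x - y) + norm (x - x\<^sub>0)) \<le> r"
      using K(2)[OF that] mult_left_mono[OF _ K(1)] by fastforce
    then have "\<alpha> * (v\<^sub>0 - 1 - K * (norm (x - y) + norm (x - x\<^sub>0))) \<le> \<alpha> * r"
      using assms by simp
    moreover have "0 \<le> (norm (x - y) - \<alpha> * K)\<^sup>2"
      by simp
    ultimately show ?thesis
      unfolding q_def power2_diff by (simp add: algebra_simps)
  qed
  have bdd: "bdd_below (case_prod q ` E)"
    by (rule bdd_belowI2[where m = "\<alpha> * (v\<^sub>0 - 1 - K * norm (x - x\<^sub>0)) - (\<alpha> * K)\<^sup>2 / 2"])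
       (auto simp: E_def bound)
  have m_le: "m \<le> q y r" if "f y \<le> ereal r" for y r
    unfolding m_def using that by (intro cInf_lower bdd) (auto simp: E_def intro!: image_eqI[where x = "(y, r)"])
  have "\<exists>y r. f y \<le> ereal r \<and> q y r < m + 1 / (real n + 1)" for n
  proof -
    have "case_prod q ` E \<noteq> {}"
      using x0 by (auto simp: E_def intro!: exI[of _ x\<^sub>0] exI[of _ v\<^sub>0])
    from cInf_lessD[OF this, of "m + 1 / (real n + 1)"] show ?thesis
      by (auto simp: m_def E_def add_pos_nonneg)
  qed
  then obtain y r where le: "\<And>n. f (y n) \<le> ereal (r n)"
    and q: "\<And>n. q (y n) (r n) < m + 1 / (real n + 1)"
    by metis
  \<comment> \<open>The midpoint of two epigraph points is again one, so its cost is at least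
    \<open>m\<close>; the parallelogram law puts it an eighth of the squared distance below the
    average cost.\<close>
  have gap: "(norm (y n - y k))\<^sup>2 \<le> 4 * (1 / (real n + 1) + 1 / (real k + 1))" for n k
  proof -
    have "m \<le> q ((1 - 1/2) *\<^sub>R y n + (1/2::real) *\<^sub>R y k) ((1 - 1/2) * r n + (1/2) * r k)"
      by (intro m_le convex_erealD conv le) auto
    also have "\<dots> = (q (y n) (r n) + q (y k) (r k)) / 2 - (norm (y n - y k))\<^sup>2 / 8"
      unfolding q_def norm_diff_midpoint_sq by (simp add: field_simps)
    finally have "m \<le> (q (y n) (r n) + q (y k) (r k)) / 2 - (norm (y n - y k))\<^sup>2 / 8" .
    moreover have "N \<le> 4 * (a + b)"
      if "m \<le> (u + v) / 2 - N / 8" "u < m + a" "v < m + b" for a b u v N :: real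
      using that by argo
    ultimately show ?thesis
      using q by blast
  qed
  have "Cauchy y"
  proof (rule metric_CauchyI)
    fix e :: real
    assume "e > 0"
    then obtain N :: nat where N: "8 / e\<^sup>2 < real N"
      using reals_Archimedean2 by blast
    have "dist (y n) (y k) < e" if "n \<ge> N" "k \<ge> N" for n k
    proof -
      have *: "1 / (real j + 1) \<le> 1 / (real N + 1)" if "j \<ge> N" for j
        using that by (simp add: frac_le)
      have "8 < e\<^sup>2 * (real N + 1)"
      proof -
        have "8 < e\<^sup>2 * real N"
          using N \<open>e > 0\<close> by (simp add: divide_less_eq mult.commute)
        also have "\<dots> \<le> e\<^sup>2 * (real N + 1)"
          by (intro mult_left_mono) auto
        finally show ?thesis .
      qed
      then have "8 * (1 / (real N + 1)) < e\<^sup>2"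
        by (simp add: divide_less_eq)
      then have "(dist (y n) (y k))\<^sup>2 < e\<^sup>2"
      proof -
        have "(dist (y n) (y k))\<^sup>2 \<le> 4 * (1 / (real n + 1) + 1 / (real k + 1))"
          using gap by (simp only: dist_norm)
        also have "\<dots> \<le> 4 * (1 / (real N + 1) + 1 / (real N + 1))"
          by (intro mult_left_mono add_mono * that) simp
        also have "\<dots> = 8 * (1 / (real N + 1))"
          by simp
        finally show ?thesis
          using \<open>8 * (1 / (real N + 1)) < e\<^sup>2\<close> by (rule order_le_less_trans)
      qed
      then show ?thesis
        by (rule power2_less_imp_less) (use \<open>e > 0\<close> in simp)
    qed
    then show "\<exists>N. \<forall>n\<ge>N. \<forall>k\<ge>N. dist (y n) (y k) < e"
      by blast
  qed
  then obtain p where p: "y \<longlonglongrightarrow> p"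
    using Cauchy_convergent convergent_def by blast
  have inv0: "(\<lambda>n. m + 1 / (real n + 1)) \<longlonglongrightarrow> m"
    using LIMSEQ_inverse_real_of_nat_add[of m] by (simp add: inverse_eq_divide add.commute)
  have "(\<lambda>n. q (y n) (r n)) \<longlonglongrightarrow> m"
    by (rule tendsto_sandwich[OF _ _ tendsto_const inv0]) (auto intro!: always_eventually m_le le less_imp_le[OF q])
  \<comment> \<open>The heights converge because the costs and the points \<open>y n\<close>
    do.\<close>
  then have "(\<lambda>n. (q (y n) (r n) - (norm (x - y n))\<^sup>2 / 2) / \<alpha>) \<longlonglongrightarrow> (m - (norm (x - p))\<^sup>2 / 2) / \<alpha>"
    using assms p by (intro tendsto_intros) auto
  then have r: "r \<longlonglongrightarrow> (m - (norm (x - p))\<^sup>2 / 2) / \<alpha>"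
    using assms by (simp add: q_def)
  define w where "w = (m - (norm (x - p))\<^sup>2 / 2) / \<alpha>"
  have fw: "f p \<le> ereal w"
    using lower_semicontinuous_epigraph_closed[OF lsc p r le] by (simp add: w_def)
  \<comment> \<open>The limit height \<open>w\<close> only bounds \<open>f p\<close> from above;
    with properness this makes \<open>f p\<close> finite, and passing from \<open>w\<close> to
    \<open>v\<close> can only lower the cost.\<close>
  then obtain v where v: "f p = ereal v"
    using proper by (metis MInfty_neq_PInfty(1) ereal_infty_less_eq(1) ereal_cases proper_def PInfty_neq_ereal(1))
  show thesis
  proof (rule that[OF v])
    fix z s
    assume "f z \<le> ereal s"
    then have "m \<le> q z s"
      by (rule m_le)
    moreover have "\<alpha> * v \<le> \<alpha> * w"
      using fw v assms by simp
    moreover have "\<alpha> * w = m - (norm (x - p))\<^sup>2 / 2"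
      using assms by (simp add: w_def)
    ultimately show "\<alpha> * v + (norm (x - p))\<^sup>2 / 2 \<le> \<alpha> * s + (norm (x - z))\<^sup>2 / 2"
      by (simp add: q_def)
  qed
qed

text \<open>Once some minimizer exists, the point selected by \<open>ARG_MIN\<close> is one too;
  comparison with the known minimizer shows that its value is finite.\<close>

lemma prox_minimizes:
  fixes f :: "'a::{real_inner, complete_space} \<Rightarrow> ereal"
  assumes "ccp f" "\<alpha> > 0"
  obtains v where "f (prox \<alpha> f x) = ereal v"
    "\<And>y r. f y \<le> ereal r \<Longrightarrow>
      \<alpha> * v + (norm (x - prox \<alpha> f x))\<^sup>2 / 2 \<le> \<alpha> * r + (norm (x - y))\<^sup>2 / 2"
proof -
  define \<phi> where "\<phi> y = ereal \<alpha> * f y + ereal (1 / 2 * (norm (x - y))\<^sup>2)" for y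
  have fin: "f y = \<infinity> \<or> (\<exists>r. f y = ereal r)" for y
    using assms(1) by (cases "f y") (auto simp: ccp_def proper_def)
  obtain p v where p: "f p = ereal v"
    "\<And>y r. f y \<le> ereal r \<Longrightarrow> \<alpha> * v + (norm (x - p))\<^sup>2 / 2 \<le> \<alpha> * r + (norm (x - y))\<^sup>2 / 2"
    using prox_minimizer_exists[OF assms] by blast
  have "\<phi> p \<le> \<phi> y" for y
    using fin[of y] p(1) p(2)[of y] assms(2) by (auto simp: \<phi>_def)
  then have "is_arg_min \<phi> (\<lambda>_. True) p"
    by (auto simp: is_arg_min_linorder)
  then have "is_arg_min \<phi> (\<lambda>_. True) (arg_min \<phi> (\<lambda>_. True))"
    unfolding arg_min_def by (rule someI)
  moreover have "prox \<alpha> f x = arg_min \<phi> (\<lambda>_. True)"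
    by (simp add: prox_def \<phi>_def[abs_def])
  ultimately have min: "\<phi> (prox \<alpha> f x) \<le> \<phi> y" for y
    by (auto simp: is_arg_min_linorder)
  have "f (prox \<alpha> f x) \<noteq> \<infinity>"
    using min[of p] p(1) assms(2) by (auto simp: \<phi>_def)
  then obtain w where w: "f (prox \<alpha> f x) = ereal w"
    using fin by blast
  show thesis
  proof (rule that[OF w])
    fix y r
    assume le: "f y \<le> ereal r"
    then obtain s where s: "f y = ereal s"
      using fin[of y] by auto
    then have "\<alpha> * s \<le> \<alpha> * r"
      using le assms(2) by simp
    then show "\<alpha> * w + (norm (x - prox \<alpha> f x))\<^sup>2 / 2 \<le> \<alpha> * r + (norm (x - y))\<^sup>2 / 2"
      using min[of y] w s by (simp add: \<phi>_def)
  qed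
qed

lemma nonneg_if_linear_perturbation_nonneg:
  fixes B C :: real
  assumes "\<And>t. 0 < t \<Longrightarrow> t \<le> 1 \<Longrightarrow> 0 \<le> B + t * C"
  shows "0 \<le> B"
proof (rule tendsto_lowerbound)
  show "((\<lambda>t. B + t * C) \<longlongrightarrow> B) (at_right 0)"
    by (auto intro!: tendsto_eq_intros)
  show "\<forall>\<^sub>F t in at_right 0. 0 \<le> B + t * C"
    using assms by (intro eventually_at_rightI[of 0 1]) auto
qed simp

text \<open>First-order optimality: compare the minimizer with the point a fraction \<open>t\<close>
  of the way to \<open>y\<close>, divide by \<open>t\<close> and let \<open>t\<close> tend to
  0.\<close>

lemma prox_subgradient:
  fixes f :: "'a::{real_inner, complete_space} \<Rightarrow> ereal"
  assumes "ccp f" "\<alpha> > 0"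
  obtains v where "f (prox \<alpha> f x) = ereal v"
    "\<And>y r. f y \<le> ereal r \<Longrightarrow> \<alpha> * v + inner (x - prox \<alpha> f x) (y - prox \<alpha> f x) \<le> \<alpha> * r"
proof -
  define p where "p = prox \<alpha> f x"
  have conv: "convex_ereal f"
    using assms by (simp add: ccp_def)
  obtain v where v: "f p = ereal v"
    "\<And>y r. f y \<le> ereal r \<Longrightarrow> \<alpha> * v + (norm (x - p))\<^sup>2 / 2 \<le> \<alpha> * r + (norm (x - y))\<^sup>2 / 2"
    using prox_minimizes[OF assms, where x = x] unfolding p_def by blast
  have "\<alpha> * v + inner (x - p) (y - p) \<le> \<alpha> * r" if le: "f y \<le> ereal r" for y r
  proof -
    have "0 \<le> (\<alpha> * (r - v) - inner (x - p) (y - p)) + t * ((norm (y - p))\<^sup>2 / 2)"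
      if t: "0 < t" "t \<le> 1" for t
    proof -
      have "f ((1 - t) *\<^sub>R p + t *\<^sub>R y) \<le> ereal ((1 - t) * v + t * r)"
        using v t le by (intro convex_erealD conv) auto
      from v(2)[OF this]
      have "\<alpha> * v + (norm (x - p))\<^sup>2 / 2 \<le> \<alpha> * ((1 - t) * v + t * r) + (norm ((x - p) - t *\<^sub>R (y - p)))\<^sup>2 / 2"
        by (simp add: algebra_simps)
      also have "(norm ((x - p) - t *\<^sub>R (y - p)))\<^sup>2
          = (norm (x - p))\<^sup>2 - 2 * t * inner (x - p) (y - p) + t\<^sup>2 * (norm (y - p))\<^sup>2"
        unfolding power2_norm_eq_inner
        by (simp add: inner_diff_left inner_diff_right inner_commute algebra_simps power2_eq_square)
      finally have "\<alpha> * v \<le> \<alpha> * ((1 - t) * v + t * r) - t * inner (x - p) (y - p) + t\<^sup>2 * (norm (y - p))\<^sup>2 / 2"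
        by (simp add: add_divide_distrib diff_divide_distrib)
      also have "\<dots> = \<alpha> * v + t * ((\<alpha> * (r - v) - inner (x - p) (y - p)) + t * ((norm (y - p))\<^sup>2 / 2))"
        by (simp add: algebra_simps power2_eq_square)
      finally have "0 \<le> t * ((\<alpha> * (r - v) - inner (x - p) (y - p)) + t * ((norm (y - p))\<^sup>2 / 2))"
        by simp
      then show ?thesis
        using t by (simp add: zero_le_mult_iff)
    qed
    from nonneg_if_linear_perturbation_nonneg[OF this] show ?thesis
      by (simp add: algebra_simps)
  qed
  then show thesis
    using that v(1) unfolding p_def by blast
qed

subsection \<open>Gradients of smooth convex functions\<close>

lemma grad_eqI:
  assumes "GDERIV (\<lambda>y. real_of_ereal (f y)) x :> D"
  shows "grad f x = D"
  unfolding grad_def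
proof (rule the_equality)
  show "GDERIV (\<lambda>y. real_of_ereal (f y)) x :> D"
    by fact
next
  fix D'
  assume "GDERIV (\<lambda>y. real_of_ereal (f y)) x :> D'"
  then have "(\<lambda>h. inner h D') = (\<lambda>h. inner h D)"
    using assms unfolding gderiv_def by (rule has_derivative_unique)
  then have "inner (D' - D) (D' - D) = 0"
    by (simp add: inner_diff_right fun_eq_iff)
  then show "D' = D"
    by simp
qed

lemma smooth_gderiv:
  assumes "smooth L f"
  shows "GDERIV (\<lambda>y. real_of_ereal (f y)) x :> grad f x"
  using assms grad_eqI unfolding smooth_def by metis

lemma convex_ereal_imp_convex_on:
  fixes f :: "'a::real_vector \<Rightarrow> ereal"
  assumes "convex_ereal f" "\<And>x. \<bar>f x\<bar> \<noteq> \<infinity>"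
  shows "convex_on UNIV (\<lambda>x. real_of_ereal (f x))"
proof (rule convex_onI)
  fix t :: real and x y :: 'a
  assume t: "0 < t" "t < 1"
  define z where "z = (1 - t) *\<^sub>R x + t *\<^sub>R y"
  have "f z \<le> ereal ((1 - t) * real_of_ereal (f x) + t * real_of_ereal (f y))"
    unfolding z_def using assms t by (intro convex_erealD) (auto simp: ereal_real')
  then have "real_of_ereal (f z) \<le> (1 - t) * real_of_ereal (f x) + t * real_of_ereal (f y)"
    using assms(2)[of z] by (cases "f z") auto
  then show "real_of_ereal (f ((1 - t) *\<^sub>R x + t *\<^sub>R y))
      \<le> (1 - t) * real_of_ereal (f x) + t * real_of_ereal (f y)"
    by (simp add: z_def)
qed simp

lemma function_class_convex_on:
  assumes "f \<in> function_class \<mu> L" "0 \<le> \<mu>" "\<And>x. \<bar>f x\<bar> \<noteq> \<infinity>"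
  shows "convex_on UNIV (\<lambda>x. real_of_ereal (f x) - \<mu> / 2 * (norm x)\<^sup>2)"
proof -
  have "convex_ereal (\<lambda>x. f x - ereal (\<mu> / 2 * (norm x)\<^sup>2))"
  \<comment> \<open>Membership grants strong convexity only for a positive modulus; at 0 the
    convexity contained in \<open>ccp\<close> is used.\<close>
  proof (cases "\<mu> = 0")
    case True
    then show ?thesis
      using assms(1) by (simp add: function_class_def ccp_def flip: zero_ereal_def)
  next
    case False
    then show ?thesis
      using assms by (auto simp: function_class_def strongly_convex_def)
  qed
  moreover have "\<bar>f x - ereal c\<bar> \<noteq> \<infinity>" "real_of_ereal (f x - ereal c) = real_of_ereal (f x) - c" for x c
    using assms(3)[of x] by (cases "f x"; simp)+
  ultimately show ?thesis
    using convex_ereal_imp_convex_on[of "\<lambda>x. f x - ereal (\<mu> / 2 * (norm x)\<^sup>2)"] by simp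
qed

lemma gderiv_along_line:
  assumes "GDERIV F (x + t *\<^sub>R u) :> D"
  shows "((\<lambda>t. F (x + t *\<^sub>R u)) has_real_derivative inner D u) (at t)"
proof -
  have "((\<lambda>t. F (x + t *\<^sub>R u)) has_derivative (\<lambda>h. inner (h *\<^sub>R u) D)) (at t)"
    by (rule has_derivative_compose[where f = "\<lambda>t. x + t *\<^sub>R u"])
      (use assms in \<open>auto simp: gderiv_def intro!: derivative_eq_intros\<close>)
  then show ?thesis
    by (simp add: has_field_derivative_def inner_commute mult.commute[of _ "inner D u"])
qed

text \<open>Restriction to the line through \<open>x\<close> and \<open>y\<close> reduces this to
  the tangent inequality in one real variable.\<close>

lemma convex_on_above_gderiv:
  assumes "convex_on UNIV F" "GDERIV F x :> D"
  shows "F x + inner D (y - x) \<le> F y"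
proof -
  define u where "u = y - x"
  have "convex_on UNIV (\<lambda>t. F (x + t *\<^sub>R u))"
  proof (rule convex_onI)
    fix t a b :: real
    assume "0 < t" "t < 1"
    moreover have "x + ((1 - t) *\<^sub>R a + t *\<^sub>R b) *\<^sub>R u = (1 - t) *\<^sub>R (x + a *\<^sub>R u) + t *\<^sub>R (x + b *\<^sub>R u)"
      by (simp add: algebra_simps)
    ultimately show "F (x + ((1 - t) *\<^sub>R a + t *\<^sub>R b) *\<^sub>R u) \<le> (1 - t) * F (x + a *\<^sub>R u) + t * F (x + b *\<^sub>R u)"
      using assms(1) by (auto intro: convex_onD)
  qed simp
  moreover have "((\<lambda>t. F (x + t *\<^sub>R u)) has_real_derivative inner D u) (at 0)"
    using assms(2) by (intro gderiv_along_line) simp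
  ultimately have "F (x + 1 *\<^sub>R u) - F (x + 0 *\<^sub>R u) \<ge> inner D u * (1 - 0)"
    by (intro convex_on_imp_above_tangent[where A = UNIV]) auto
  then show ?thesis
    by (simp add: u_def)
qed

text \<open>The descent lemma: along the segment, \<open>\<phi>\<close> is the function minus its
  quadratic model up to a constant, and its derivative is nonpositive by Cauchy-Schwarz and the
  Lipschitz bound.\<close>

lemma lipschitz_gradient_descent:
  assumes G: "\<And>x. GDERIV F x :> G x" and lip: "L-lipschitz_on UNIV G"
  shows "F y \<le> F x + inner (G x) (y - x) + L / 2 * (norm (y - x))\<^sup>2"
proof -
  define u where "u = y - x"
  define \<phi> where "\<phi> t = F (x + t *\<^sub>R u) - t * inner (G x) u - L / 2 * t\<^sup>2 * (norm u)\<^sup>2" for t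
  have "\<exists>D. DERIV \<phi> t :> D \<and> D \<le> 0" if "0 \<le> t" "t \<le> 1" for t
  proof (intro exI conjI)
    show "DERIV \<phi> t :> inner (G (x + t *\<^sub>R u)) u - inner (G x) u - L * t * (norm u)\<^sup>2"
      unfolding \<phi>_def by (auto intro!: derivative_eq_intros gderiv_along_line G)
    have "inner (G (x + t *\<^sub>R u) - G x) u \<le> norm (G (x + t *\<^sub>R u) - G x) * norm u"
      by (rule norm_cauchy_schwarz)
    also have "norm (G (x + t *\<^sub>R u) - G x) \<le> L * (t * norm u)"
      using lipschitz_onD[OF lip, of "x + t *\<^sub>R u" x] that by (simp add: dist_norm)
    finally show "inner (G (x + t *\<^sub>R u)) u - inner (G x) u - L * t * (norm u)\<^sup>2 \<le> 0"
      by (simp add: inner_diff_left power2_eq_square mult_right_mono mult.assoc)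
  qed
  then have "\<phi> 1 \<le> \<phi> 0"
    by (rule DERIV_nonpos_imp_nonincreasing[OF zero_le_one])
  then show ?thesis
    by (simp add: \<phi>_def u_def)
qed

text \<open>The Baillon-Haddad argument, started from two quadratic bounds instead of a Lipschitz
  condition: these are what is at hand once a multiple of the squared norm has been
  subtracted.\<close>

lemma gradient_cocoercive:
  fixes G :: "'a::real_inner \<Rightarrow> 'a"
  assumes d: "d > 0"
    and lower: "\<And>x y. F x + inner (G x) (y - x) \<le> F y"
    and upper: "\<And>x y. F y \<le> F x + inner (G x) (y - x) + d / 2 * (norm (y - x))\<^sup>2"
  shows "(norm (G x - G y))\<^sup>2 \<le> d * inner (x - y) (G x - G y)"
proof -
  have half: "F x + inner (G x) (y - x) + (norm (G y - G x))\<^sup>2 / (2 * d) \<le> F y" for x y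
  proof -
    define g where "g = G y - G x"
    \<comment> \<open>The minimizer of the upper model at \<open>y\<close> minus the tangent of
      \<open>F\<close> at \<open>x\<close>, that is, a gradient step of length
      \<open>1 / d\<close>.\<close>
    define t where "t = y - (1 / d) *\<^sub>R g"
    have "F x + inner (G x) (t - x) \<le> F y + inner (G y) (t - y) + d / 2 * (norm (t - y))\<^sup>2"
      using lower[of x t] upper[of t y] by linarith
    moreover have "inner (G x) (t - x) = inner (G x) (y - x) - inner (G x) g / d"
      by (simp add: t_def inner_diff_right)
    moreover have "inner (G y) (t - y) = - inner (G y) g / d"
      by (simp add: t_def)
    moreover have "d / 2 * (norm (t - y))\<^sup>2 = (norm g)\<^sup>2 / (2 * d)"
      using d by (simp add: t_def power_mult_distrib power_divide power2_eq_square)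
    moreover have "inner (G y) g / d - inner (G x) g / d = 2 * ((norm g)\<^sup>2 / (2 * d))"
      by (simp add: power2_norm_eq_inner g_def inner_diff_left diff_divide_distrib)
    ultimately show ?thesis
      unfolding g_def by linarith
  qed
  have "inner (G x) (y - x) + inner (G y) (x - y) = - inner (x - y) (G x - G y)"
    by (simp add: inner_diff_left inner_diff_right inner_commute)
  moreover have "(norm (G y - G x))\<^sup>2 / (2 * d) = (norm (G x - G y))\<^sup>2 / (2 * d)"
    by (simp add: norm_minus_commute)
  ultimately have "2 * ((norm (G x - G y))\<^sup>2 / (2 * d)) \<le> inner (x - y) (G x - G y)"
    using half[of x y] half[of y x] by linarith
  then show ?thesis
    using d by (simp add: divide_le_eq mult.commute)
qed

text \<open>Subtracting \<open>\<mu> / 2 * (norm x)\<^sup>2\<close> leaves a convex function and,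
  since that quadratic has remainder exactly \<open>\<mu> / 2 * (norm (y - x))\<^sup>2\<close>,
  lowers the constant of the descent lemma from \<open>L\<close> to
  \<open>L - \<mu>\<close>.\<close>

lemma function_class_grad_cocoercive:
  assumes f: "f \<in> function_class \<mu> (ereal L)" and \<mu>: "0 \<le> \<mu>" "\<mu> < L"
  defines "G \<equiv> \<lambda>x. grad f x - \<mu> *\<^sub>R x"
  shows "(norm (G x - G y))\<^sup>2 \<le> (L - \<mu>) * inner (x - y) (G x - G y)"
proof (rule gradient_cocoercive[where F = "\<lambda>x. real_of_ereal (f x) - \<mu> / 2 * (norm x)\<^sup>2"])
  have sm: "smooth L f"
    using f by (simp add: function_class_def)
  then have fin: "\<bar>f x\<bar> \<noteq> \<infinity>" for x
    by (simp add: smooth_def)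
  have G: "GDERIV (\<lambda>x. real_of_ereal (f x) - \<mu> / 2 * (norm x)\<^sup>2) x :> G x" for x
    using smooth_gderiv[OF sm, of x] unfolding gderiv_def G_def power2_norm_eq_inner
    by (auto intro!: derivative_eq_intros simp: inner_diff_right inner_commute algebra_simps)
  show "0 < L - \<mu>"
    using \<mu> by simp
  fix x y
  show "real_of_ereal (f x) - \<mu> / 2 * (norm x)\<^sup>2 + inner (G x) (y - x) \<le> real_of_ereal (f y) - \<mu> / 2 * (norm y)\<^sup>2"
    by (rule convex_on_above_gderiv[OF function_class_convex_on[OF f \<mu>(1) fin] G])
  have "real_of_ereal (f y) \<le> real_of_ereal (f x) + inner (grad f x) (y - x) + L / 2 * (norm (y - x))\<^sup>2"
    using sm by (intro lipschitz_gradient_descent smooth_gderiv[OF sm]) (simp add: smooth_def)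
  then show "real_of_ereal (f y) - \<mu> / 2 * (norm y)\<^sup>2
     \<le> real_of_ereal (f x) - \<mu> / 2 * (norm x)\<^sup>2 + inner (G x) (y - x) + (L - \<mu>) / 2 * (norm (y - x))\<^sup>2"
    unfolding G_def power2_norm_eq_inner
    by (simp add: inner_diff_left inner_diff_right inner_commute field_simps)
qed

section \<open>Two quadratic inequalities in an inner product space\<close>

text \<open>The hypothesis puts \<open>(X, Y, Z) = (\<parallel>z\<parallel>\<^sup>2, \<langle>z, u\<rangle>, \<parallel>u\<parallel>\<^sup>2)\<close> in the region \<open>P Y \<le> X \<le> Q Y\<close> and
  bounds \<open>Z\<close> by an affine function of \<open>Y\<close>; the claim is then affine in \<open>Y\<close>, so it suffices to
  check it at \<open>Y = X / P\<close> and \<open>Y = X / Q\<close>.\<close>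

lemma resolvent_quadratic_bound:
  fixes z u :: "'a::real_inner"
  assumes PQ: "0 < P" "P < Q" and c: "0 \<le> c"
    and sector: "0 \<le> inner (z - P *\<^sub>R u) (Q *\<^sub>R u - z)"
    and n: "n \<le> (2 - c / P) / P" "n \<le> (2 - c / Q) / Q"
  shows "n * (norm z)\<^sup>2 \<le> 2 * inner z u - c * (norm u)\<^sup>2"
proof -
  define X Y Z where "X = (norm z)\<^sup>2" and "Y = inner z u" and "Z = (norm u)\<^sup>2"
  have sec: "P * Q * Z \<le> (P + Q) * Y - X"
    using sector unfolding X_def Y_def Z_def power2_norm_eq_inner
    by (simp add: inner_diff_left inner_diff_right inner_commute algebra_simps)
  have "0 \<le> (norm (Q *\<^sub>R u - z))\<^sup>2" "0 \<le> (norm (z - P *\<^sub>R u))\<^sup>2"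
    by simp_all
  then have sq: "0 \<le> Q\<^sup>2 * Z - 2 * Q * Y + X" "0 \<le> X - 2 * P * Y + P\<^sup>2 * Z"
    unfolding X_def Y_def Z_def power2_norm_eq_inner
    by (simp_all add: inner_diff_left inner_diff_right inner_commute algebra_simps power2_eq_square)
  \<comment> \<open>The multipliers are chosen to cancel \<open>Z\<close>; exchanging the roles of
    \<open>P\<close> and \<open>Q\<close> gives the other edge of the region.\<close>
  have "0 \<le> P * (Q\<^sup>2 * Z - 2 * Q * Y + X) + Q * ((P + Q) * Y - X - P * Q * Z)"
    using sq sec PQ by simp
  also have "\<dots> = (Q - P) * (Q * Y - X)"
    by (simp add: algebra_simps power2_eq_square)
  finally have XQ: "0 \<le> Q * Y - X"
    using PQ by (simp add: zero_le_mult_iff)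
  have "0 \<le> Q * (X - 2 * P * Y + P\<^sup>2 * Z) + P * ((P + Q) * Y - X - P * Q * Z)"
    using sq sec PQ by simp
  also have "\<dots> = (Q - P) * (X - P * Y)"
    by (simp add: algebra_simps power2_eq_square)
  finally have XP: "0 \<le> X - P * Y"
    using PQ by (simp add: zero_le_mult_iff)
  have n': "n * P \<le> 2 - c / P" "n * Q \<le> 2 - c / Q"
    using n PQ by (simp_all add: pos_le_divide_eq)
  \<comment> \<open>Interpolation in \<open>Y\<close>: the weight \<open>Q * Y - X\<close> vanishes
    at \<open>Y = X / Q\<close> and the weight \<open>X - P * Y\<close> at \<open>Y = X / P\<close>,
    so each bound on \<open>n\<close> acts at its own endpoint.\<close>
  have "(Q - P) * (n * X) = (n * P) * (Q * Y - X) + (n * Q) * (X - P * Y)"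
    by (simp add: algebra_simps)
  also have "\<dots> \<le> (2 - c / P) * (Q * Y - X) + (2 - c / Q) * (X - P * Y)"
    using n' XQ XP by (intro add_mono mult_right_mono)
  also have "\<dots> = (Q - P) * (2 * Y - c * (((P + Q) * Y - X) / (P * Q)))"
    using PQ by (simp add: field_simps)
  also have "\<dots> \<le> (Q - P) * (2 * Y - c * Z)"
    using PQ c sec by (intro mult_left_mono diff_left_mono) (simp_all add: pos_le_divide_eq mult.commute)
  finally show ?thesis
    using PQ by (simp add: X_def Y_def Z_def)
qed

text \<open>Minimising the right-hand side minus the left-hand side over \<open>e\<close>, the discriminant is
  \<open>(\<theta> - \<nu>)\<close> times the slack in the hypothesis on \<open>v\<close>. This replaces the Cauchy-Schwarz step of the
  commutative (scaled relative graph) picture.\<close>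

lemma perturbed_resolvent_bound:
  fixes s v e :: "'a::real_inner"
  assumes \<theta>: "0 < \<theta>" and d: "0 < d" and c: "\<theta> * c = 1 + \<theta> * d / 2"
    and \<nu>: "c * \<nu> \<le> 1"
    and sv: "\<nu> * (norm s)\<^sup>2 \<le> 2 * inner s v - c * (norm v)\<^sup>2"
  shows "(norm (\<theta> *\<^sub>R s - v + (\<theta> * d / 2) *\<^sub>R e))\<^sup>2
      \<le> (\<theta> - \<nu>) * (\<theta> * (norm (s + (d / 2) *\<^sub>R e))\<^sup>2 + d / 2 * (norm e)\<^sup>2)"
proof -
  define h where "h = d / 2"
  define b where "b = \<theta> * h"
  define X Y Z where "X = (norm s)\<^sup>2" and "Y = inner s v" and "Z = (norm v)\<^sup>2"
  \<comment> \<open>The right-hand side minus the left-hand side is quadratic in \<open>e\<close>,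
    with constant term \<open>K\<close>, linear term \<open>2 * b * inner y e\<close> and leading
    coefficient \<open>b * \<tau>\<close>.\<close>
  define y where "y = v - \<nu> *\<^sub>R s"
  define K where "K = \<theta> * (2 * Y - \<nu> * X) - Z"
  define \<tau> where "\<tau> = 1 - c * \<nu>"
  have b: "0 < b" "\<theta> * c = 1 + b" and \<tau>: "0 \<le> \<tau>"
    using \<theta> d c \<nu> by (auto simp: b_def h_def \<tau>_def)
  have "0 < \<theta> * c"
    using b by linarith
  then have "0 < c"
    using \<theta> by (simp add: zero_less_mult_iff)
  moreover have "c * \<nu> < c * \<theta>"
    using b \<nu> by (simp add: mult.commute)
  ultimately have \<nu>\<theta>: "\<nu> < \<theta>"
    by simp
  have slack: "0 \<le> 2 * Y - c * Z - \<nu> * X"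
    using sv by (simp add: X_def Y_def Z_def)
  have ysq: "(norm y)\<^sup>2 = Z - 2 * \<nu> * Y + \<nu>\<^sup>2 * X"
    unfolding y_def X_def Y_def Z_def power2_norm_eq_inner
    by (simp add: inner_diff_left inner_diff_right inner_commute algebra_simps power2_eq_square)
  have "\<tau> * K - b * (norm y)\<^sup>2 = \<tau> * K - (\<theta> * c - 1) * (Z - 2 * \<nu> * Y + \<nu>\<^sup>2 * X)"
    using b by (simp add: ysq)
  also have "\<dots> = (\<theta> - \<nu>) * (2 * Y - c * Z - \<nu> * X)"
    unfolding \<tau>_def K_def by (simp add: algebra_simps power2_eq_square)
  finally have "\<tau> * K - b * (norm y)\<^sup>2 = (\<theta> - \<nu>) * (2 * Y - c * Z - \<nu> * X)" .
  moreover have "0 \<le> (\<theta> - \<nu>) * (2 * Y - c * Z - \<nu> * X)"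
    using slack \<nu>\<theta> by (intro mult_nonneg_nonneg) auto
  ultimately have disc: "b * (norm y)\<^sup>2 \<le> \<tau> * K"
    by simp
  have "0 \<le> K + 2 * b * inner y e + b * \<tau> * (norm e)\<^sup>2"
  proof (cases "\<tau> = 0")
    \<comment> \<open>The quadratic degenerates: \<open>disc\<close> forces \<open>y = 0\<close>,
      and \<open>K\<close> equals \<theta> times the slack plus \<open>b * Z\<close>.\<close>
    case True
    then have "y = 0"
      using disc b by (simp add: mult_le_0_iff)
    have "0 \<le> \<theta> * (2 * Y - c * Z - \<nu> * X) + b * Z"
      using slack b \<theta> by (simp add: Z_def)
    also have "\<dots> = K + (1 + b - \<theta> * c) * Z"
      by (simp add: K_def algebra_simps)
    finally show ?thesis
      using True \<open>y = 0\<close> b by simp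
  next
    case False
    have "0 \<le> b * (norm (y + \<tau> *\<^sub>R e))\<^sup>2"
      using b by simp
    also have "\<dots> = b * (norm y)\<^sup>2 + \<tau> * (2 * b * inner y e + b * \<tau> * (norm e)\<^sup>2)"
      unfolding power2_norm_eq_inner
      by (simp add: inner_add_left inner_add_right inner_commute algebra_simps)
    also have "\<dots> \<le> \<tau> * (K + 2 * b * inner y e + b * \<tau> * (norm e)\<^sup>2)"
      using disc by (simp add: algebra_simps)
    finally show ?thesis
      using \<tau> False by (simp add: zero_le_mult_iff)
  qed
  \<comment> \<open>The last summand is zero because \<open>\<theta> * c = 1 + b\<close>; including
    it makes the equation a polynomial identity.\<close>
  also have "K + 2 * b * inner y e + b * \<tau> * (norm e)\<^sup>2
    = (\<theta> - \<nu>) * (\<theta> * (norm (s + h *\<^sub>R e))\<^sup>2 + h * (norm e)\<^sup>2)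
      - (norm (\<theta> *\<^sub>R s - v + (\<theta> * h) *\<^sub>R e))\<^sup>2
      + h * (norm e)\<^sup>2 * \<nu> * (1 + b - \<theta> * c)"
    unfolding K_def y_def \<tau>_def X_def Y_def Z_def power2_norm_eq_inner b_def
    by (simp add: inner_add_left inner_add_right inner_diff_left inner_diff_right inner_commute
        algebra_simps power2_eq_square)
  finally show ?thesis
    using b by (simp add: h_def)
qed

subsection \<open>Proximal bounds and the contraction estimate\<close>

text \<open>By \<open>prox_subgradient\<close> the proximal point \<open>p\<close> minimizes
  \<open>\<alpha> * F y - inner (x - p) y\<close>, so the derivative of this function vanishes
  there.\<close>

lemma prox_grad:
  fixes f :: "'a::{real_inner, complete_space} \<Rightarrow> ereal"
  assumes "ccp f" "smooth L f" "\<alpha> > 0"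
  shows "x - prox \<alpha> f x = \<alpha> *\<^sub>R grad f (prox \<alpha> f x)"
proof -
  define F where "F y = real_of_ereal (f y)" for y
  define p where "p = prox \<alpha> f x"
  have F: "f y = ereal (F y)" for y
    using assms(2) by (simp add: smooth_def F_def ereal_real')
  obtain v where v: "f p = ereal v"
    "\<And>y r. f y \<le> ereal r \<Longrightarrow> \<alpha> * v + inner (x - p) (y - p) \<le> \<alpha> * r"
    using prox_subgradient[OF assms(1,3), where x = x] unfolding p_def by blast
  have min: "\<alpha> * F p - inner (x - p) p \<le> \<alpha> * F y - inner (x - p) y" for y
    using v(1) v(2)[of y "F y"] F by (simp add: inner_diff_right)
  have "((\<lambda>y. \<alpha> * F y - inner (x - p) y) has_derivative
      (\<lambda>h. \<alpha> * inner h (grad f p) - inner (x - p) h)) (at p)"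
    using smooth_gderiv[OF assms(2), of p] unfolding gderiv_def F_def
    by (auto intro!: derivative_eq_intros)
  then have "(\<lambda>h. \<alpha> * inner h (grad f p) - inner (x - p) h) = (\<lambda>h. 0)"
    by (rule has_derivative_local_min) (simp add: min)
  then have "inner h (\<alpha> *\<^sub>R grad f p - (x - p)) = 0" for h
    by (drule_tac x = h in fun_cong) (simp add: inner_diff_left inner_diff_right inner_commute)
  then have "\<alpha> *\<^sub>R grad f p - (x - p) = 0"
    using inner_eq_zero_iff by blast
  then show ?thesis
    by (simp add: p_def)
qed

text \<open>Monotonicity of the subdifferential: test each subgradient inequality at the other
  proximal point and add.\<close>

lemma prox_firmly_nonexpansive:
  fixes f :: "'a::{real_inner, complete_space} \<Rightarrow> ereal" and x y :: 'a
  assumes "ccp f" "\<alpha> > 0"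
  defines "u \<equiv> prox \<alpha> f x - prox \<alpha> f y"
  shows "(norm u)\<^sup>2 \<le> inner (x - y) u"
proof -
  let ?p = "prox \<alpha> f x" and ?q = "prox \<alpha> f y"
  obtain v where v: "f ?p = ereal v"
    "\<And>z r. f z \<le> ereal r \<Longrightarrow> \<alpha> * v + inner (x - ?p) (z - ?p) \<le> \<alpha> * r"
    using prox_subgradient[OF assms(1,2)] by blast
  obtain w where w: "f ?q = ereal w"
    "\<And>z r. f z \<le> ereal r \<Longrightarrow> \<alpha> * w + inner (y - ?q) (z - ?q) \<le> \<alpha> * r"
    using prox_subgradient[OF assms(1,2)] by blast
  have "inner (x - ?p) (?q - ?p) + inner (y - ?q) (?p - ?q) \<le> 0"
    using v(2)[of ?q w] w(2)[of ?p v] v(1) w(1) by simp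
  then show ?thesis
    unfolding u_def power2_norm_eq_inner
    by (simp add: inner_diff_left inner_diff_right inner_commute algebra_simps)
qed

text \<open>For finite \<open>L\<close>, cocoercivity of the gradient becomes the sector condition
  with slopes \<open>P\<close> and \<open>Q\<close>, and the two entries of \<open>dys_nu\<close>,
  times \<alpha>, are the endpoint values in \<open>resolvent_quadratic_bound\<close>. For infinite
  \<open>L\<close> the coefficient is 0 and firm nonexpansiveness suffices.\<close>

lemma prox_quadratic_bound:
  fixes f :: "'a::{real_inner, complete_space} \<Rightarrow> ereal" and x y :: 'a
  assumes f: "f \<in> function_class \<mu> L" and \<mu>: "0 \<le> \<mu>" "ereal \<mu> < L" and \<alpha>: "\<alpha> > 0"
    and k: "0 \<le> k" "\<alpha> * k \<le> 2"
  defines "u \<equiv> prox \<alpha> f x - prox \<alpha> f y"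
  shows "\<alpha> * dys_nu \<alpha> \<mu> L k * (norm (x - y))\<^sup>2
      \<le> 2 * inner (x - y) u - (2 - \<alpha> * k) * (norm u)\<^sup>2"
proof (cases "L = \<infinity>")
  case True
  have "0 \<le> (2 * \<mu> + k) / (1 + \<alpha> * \<mu>)\<^sup>2"
    using \<mu> k by simp
  then have "dys_nu \<alpha> \<mu> L k = 0"
    using True by (simp add: dys_nu_def)
  moreover have "(norm u)\<^sup>2 \<le> inner (x - y) u"
    unfolding u_def using f \<alpha> by (intro prox_firmly_nonexpansive) (auto simp: function_class_def)
  moreover have "0 \<le> \<alpha> * k * (norm u)\<^sup>2"
    using \<alpha> k by simp
  ultimately show ?thesis
    by (simp add: algebra_simps)
next
  case False
  then obtain M where L: "L = ereal M" and M: "\<mu> < M"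
    using \<mu> by (cases L) auto
  define p q where "p = prox \<alpha> f x" and "q = prox \<alpha> f y"
  have u: "u = p - q"
    by (simp add: u_def p_def q_def)
  define P Q where "P = 1 + \<alpha> * \<mu>" and "Q = 1 + \<alpha> * M"
  have PQ: "0 < P" "P < Q"
    using \<alpha> \<mu> M by (auto simp: P_def Q_def add_pos_nonneg)
  have "ccp f" "smooth M f"
    using f by (auto simp: function_class_def L)
  then have opt: "x = p + \<alpha> *\<^sub>R grad f p" "y = q + \<alpha> *\<^sub>R grad f q"
    using prox_grad[of f M \<alpha>] \<alpha> by (simp_all add: p_def q_def algebra_simps)
  define w where "w = (grad f p - \<mu> *\<^sub>R p) - (grad f q - \<mu> *\<^sub>R q)"
  have "(norm w)\<^sup>2 \<le> (M - \<mu>) * inner (p - q) w"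
    unfolding w_def using f \<mu> M by (intro function_class_grad_cocoercive) (auto simp: L)
  then have "0 \<le> inner w ((M - \<mu>) *\<^sub>R u - w)"
    by (simp add: u_def p_def q_def inner_diff_right inner_commute power2_norm_eq_inner)
  then have "0 \<le> \<alpha>\<^sup>2 * inner w ((M - \<mu>) *\<^sub>R u - w)"
    by simp
  also have "\<dots> = inner (\<alpha> *\<^sub>R w) ((\<alpha> * (M - \<mu>)) *\<^sub>R u - \<alpha> *\<^sub>R w)"
    by (simp add: power2_eq_square inner_diff_right algebra_simps)
  also have "\<alpha> *\<^sub>R w = (x - y) - P *\<^sub>R u"
    unfolding w_def u P_def using opt by (simp add: algebra_simps)
  also have "(\<alpha> * (M - \<mu>)) *\<^sub>R u - ((x - y) - P *\<^sub>R u) = Q *\<^sub>R u - (x - y)"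
    by (simp add: P_def Q_def algebra_simps)
  finally have sector: "0 \<le> inner ((x - y) - P *\<^sub>R u) (Q *\<^sub>R u - (x - y))" .
  have end_pt: "\<alpha> * ((2 * t + k) / (1 + \<alpha> * t)\<^sup>2) = (2 - (2 - \<alpha> * k) / (1 + \<alpha> * t)) / (1 + \<alpha> * t)"
    if "0 < 1 + \<alpha> * t" for t
    using that by (simp add: divide_simps power2_eq_square) (simp add: algebra_simps)
  have "\<alpha> * dys_nu \<alpha> \<mu> L k \<le> \<alpha> * ((2 * \<mu> + k) / (1 + \<alpha> * \<mu>)\<^sup>2)"
    "\<alpha> * dys_nu \<alpha> \<mu> L k \<le> \<alpha> * ((2 * M + k) / (1 + \<alpha> * M)\<^sup>2)"
    unfolding dys_nu_def L using \<alpha> by (intro mult_left_mono; simp)+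
  then have "\<alpha> * dys_nu \<alpha> \<mu> L k \<le> (2 - (2 - \<alpha> * k) / P) / P"
    "\<alpha> * dys_nu \<alpha> \<mu> L k \<le> (2 - (2 - \<alpha> * k) / Q) / Q"
    using PQ end_pt[of \<mu>] end_pt[of M] by (simp_all add: P_def Q_def)
  then show ?thesis
    using PQ k sector by (intro resolvent_quadratic_bound[where P = P and Q = Q]) auto
qed

text \<open>Arithmetic-geometric mean: the factors \<open>2 - \<alpha> * k\<close> and
  \<open>2 * m + \<alpha> * k\<close> add up to \<open>2 * (1 + m)\<close>. The bound keeps
  \<open>\<theta> - \<alpha> * \<nu>\<close> nonnegative and feeds
  \<open>perturbed_resolvent_bound\<close>.\<close>

lemma dys_nu_upper_bound:
  assumes "0 \<le> \<mu>" "0 < \<alpha>" "\<alpha> * k \<le> 2"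
  shows "(2 - \<alpha> * k) * (\<alpha> * dys_nu \<alpha> \<mu> L k) \<le> 1"
proof -
  define m where "m = \<alpha> * \<mu>"
  have m: "0 \<le> m"
    using assms by (simp add: m_def)
  have "(2 - \<alpha> * k) * (\<alpha> * dys_nu \<alpha> \<mu> L k) \<le> (2 - \<alpha> * k) * (\<alpha> * ((2 * \<mu> + k) / (1 + m)\<^sup>2))"
    using assms by (intro mult_left_mono) (auto simp: dys_nu_def m_def)
  also have "\<dots> = (2 - \<alpha> * k) * (2 * m + \<alpha> * k) / (1 + m)\<^sup>2"
    by (simp add: m_def algebra_simps)
  also have "\<dots> \<le> 1"
  proof -
    have "0 \<le> (m + \<alpha> * k - 1)\<^sup>2"
      by simp
    also have "\<dots> = (1 + m)\<^sup>2 - (2 - \<alpha> * k) * (2 * m + \<alpha> * k)"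
      by (simp add: power2_eq_square algebra_simps)
    finally show ?thesis
      using m by (simp add: divide_le_eq)
  qed
  finally show ?thesis .
qed

lemma dys_core_bound:
  fixes f g h :: "'a::{real_inner, complete_space} \<Rightarrow> ereal"
  assumes f: "f \<in> function_class \<mu>\<^sub>f L\<^sub>f" "0 \<le> \<mu>\<^sub>f" "ereal \<mu>\<^sub>f < L\<^sub>f"
    and g: "g \<in> function_class \<mu>\<^sub>g L\<^sub>g" "0 \<le> \<mu>\<^sub>g" "ereal \<mu>\<^sub>g < L\<^sub>g"
    and h: "h \<in> function_class \<mu>\<^sub>h (ereal L\<^sub>h)" "0 \<le> \<mu>\<^sub>h" "\<mu>\<^sub>h < L\<^sub>h"
    and \<alpha>: "\<alpha> > 0" "\<alpha> * (\<mu>\<^sub>h + L\<^sub>h) < 4"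
  defines "\<theta> \<equiv> 2 / (4 - \<alpha> * (\<mu>\<^sub>h + L\<^sub>h))"
  defines "\<nu>\<^sub>f \<equiv> dys_nu \<alpha> \<mu>\<^sub>f L\<^sub>f \<mu>\<^sub>h" and "\<nu>\<^sub>g \<equiv> dys_nu \<alpha> \<mu>\<^sub>g L\<^sub>g \<mu>\<^sub>h"
  defines "R \<equiv> \<lambda>x. \<theta> *\<^sub>R x - prox \<alpha> g x
             + prox \<alpha> f (2 *\<^sub>R prox \<alpha> g x - x - \<alpha> *\<^sub>R grad h (prox \<alpha> g x))"
  shows "0 \<le> (\<theta> - \<alpha> * \<nu>\<^sub>f) * (\<theta> - \<alpha> * \<nu>\<^sub>g)"
    and "norm (R x - R y) \<le> sqrt ((\<theta> - \<alpha> * \<nu>\<^sub>f) * (\<theta> - \<alpha> * \<nu>\<^sub>g)) * norm (x - y)"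
proof -
  define k where "k = \<alpha> * \<mu>\<^sub>h"
  define d where "d = \<alpha> * (L\<^sub>h - \<mu>\<^sub>h)"
  define c where "c = 2 - k"
  have d: "0 < d" and k: "0 \<le> k" and cd: "d < 2 * c" and \<theta>_cd: "\<theta> = 2 / (2 * c - d)"
    using \<alpha> h by (auto simp: d_def k_def c_def \<theta>_def algebra_simps)
  then have \<theta>: "0 < \<theta>" and \<theta>c: "\<theta> * c = 1 + \<theta> * d / 2" and c: "0 < c" and k2: "\<alpha> * \<mu>\<^sub>h \<le> 2"
    by (auto simp: \<theta>_cd field_simps c_def k_def)
  have nu: "c * (\<alpha> * \<nu>\<^sub>f) \<le> 1" "c * (\<alpha> * \<nu>\<^sub>g) \<le> 1"
    using dys_nu_upper_bound f g \<alpha> k2 by (auto simp: c_def k_def \<nu>\<^sub>f_def \<nu>\<^sub>g_def)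
  have "1 \<le> c * \<theta>"
    using \<theta>c \<theta> d by (simp add: mult.commute)
  then have "c * (\<alpha> * \<nu>\<^sub>f) \<le> c * \<theta>" "c * (\<alpha> * \<nu>\<^sub>g) \<le> c * \<theta>"
    using nu by linarith+
  then have nonneg: "0 \<le> \<theta> - \<alpha> * \<nu>\<^sub>f" "0 \<le> \<theta> - \<alpha> * \<nu>\<^sub>g"
    using c by simp_all
  then show prod_nonneg: "0 \<le> (\<theta> - \<alpha> * \<nu>\<^sub>f) * (\<theta> - \<alpha> * \<nu>\<^sub>g)"
    by simp
  define S where "S x = 2 *\<^sub>R prox \<alpha> g x - x - \<alpha> *\<^sub>R grad h (prox \<alpha> g x)" for x
  define z where "z = x - y"
  define u where "u = prox \<alpha> g x - prox \<alpha> g y"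
  define s where "s = S x - S y"
  define v where "v = prox \<alpha> f (S x) - prox \<alpha> f (S y)"
  define w where "w = (grad h (prox \<alpha> g x) - \<mu>\<^sub>h *\<^sub>R prox \<alpha> g x) - (grad h (prox \<alpha> g y) - \<mu>\<^sub>h *\<^sub>R prox \<alpha> g y)"
  \<comment> \<open>Cocoercivity confines \<open>\<alpha> *\<^sub>R w\<close> to the ball with
    diameter from 0 to \<open>d *\<^sub>R u\<close>; \<open>e\<close> is its offset from the centre,
    scaled so that the radius becomes \<open>norm u\<close>.\<close>
  define e where "e = (2 / d) *\<^sub>R (\<alpha> *\<^sub>R w) - u"
  have "(norm w)\<^sup>2 \<le> (L\<^sub>h - \<mu>\<^sub>h) * inner u w"
    unfolding w_def u_def using h by (intro function_class_grad_cocoercive) auto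
  then have "\<alpha>\<^sup>2 * (norm w)\<^sup>2 \<le> \<alpha>\<^sup>2 * ((L\<^sub>h - \<mu>\<^sub>h) * inner u w)"
    by (intro mult_left_mono) auto
  then have w: "(norm (\<alpha> *\<^sub>R w))\<^sup>2 \<le> d * inner u (\<alpha> *\<^sub>R w)"
    by (simp add: d_def power_mult_distrib power2_eq_square mult_ac)
  have \<alpha>w: "\<alpha> *\<^sub>R w = (d / 2) *\<^sub>R (u + e)"
    using d by (simp add: e_def)
  have "(d / 2)\<^sup>2 * (norm (u + e))\<^sup>2 \<le> (d / 2)\<^sup>2 * (2 * inner u (u + e))"
    using w unfolding \<alpha>w by (simp add: power_mult_distrib power2_eq_square)
  then have "(norm (u + e))\<^sup>2 \<le> 2 * inner u (u + e)"
    using d by simp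
  then have e: "(norm e)\<^sup>2 \<le> (norm u)\<^sup>2"
    unfolding power2_norm_eq_inner by (simp add: inner_add_left inner_add_right inner_commute)
  have s: "s = 2 *\<^sub>R u - z - k *\<^sub>R u - \<alpha> *\<^sub>R w"
    by (simp add: s_def S_def u_def z_def w_def k_def algebra_simps)
  \<comment> \<open>Adding back the offset leaves only \<open>u\<close> and \<open>z\<close>, and
    \<theta> is the factor that gives \<open>u\<close> the coefficient 1.\<close>
  have "\<theta> *\<^sub>R (s + (d / 2) *\<^sub>R e) = (\<theta> * c - \<theta> * d / 2) *\<^sub>R u - \<theta> *\<^sub>R z"
    unfolding s \<alpha>w c_def by (simp add: algebra_simps)
  then have q: "\<theta> *\<^sub>R (s + (d / 2) *\<^sub>R e) = u - \<theta> *\<^sub>R z"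
    by (simp add: \<theta>c)
  have R: "R x - R y = - (\<theta> *\<^sub>R s - v + (\<theta> * d / 2) *\<^sub>R e)"
  proof -
    have "R x - R y = \<theta> *\<^sub>R z - u + v"
      by (simp add: R_def z_def u_def v_def S_def algebra_simps)
    also have "\<dots> = v - \<theta> *\<^sub>R (s + (d / 2) *\<^sub>R e)"
      unfolding q by simp
    finally show ?thesis
      by (simp add: algebra_simps)
  qed
  have "\<alpha> * \<nu>\<^sub>f * (norm s)\<^sup>2 \<le> 2 * inner s v - c * (norm v)\<^sup>2"
    unfolding s_def v_def \<nu>\<^sub>f_def c_def k_def
    using f h \<alpha> k2 by (intro prox_quadratic_bound) auto
  then have "(norm (R x - R y))\<^sup>2
      \<le> (\<theta> - \<alpha> * \<nu>\<^sub>f) * (\<theta> * (norm (s + (d / 2) *\<^sub>R e))\<^sup>2 + d / 2 * (norm e)\<^sup>2)"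
    unfolding R norm_minus_cancel by (rule perturbed_resolvent_bound[OF \<theta> d \<theta>c nu(1)])
  also have "\<dots> \<le> (\<theta> - \<alpha> * \<nu>\<^sub>f) * (\<theta> * (norm (s + (d / 2) *\<^sub>R e))\<^sup>2 + d / 2 * (norm u)\<^sup>2)"
    using nonneg e d by (intro mult_left_mono add_left_mono) auto
  also have "\<dots> \<le> (\<theta> - \<alpha> * \<nu>\<^sub>f) * ((\<theta> - \<alpha> * \<nu>\<^sub>g) * (norm z)\<^sup>2)"
  proof (intro mult_left_mono nonneg)
    \<comment> \<open>Multiplying by \<theta> makes \<open>q\<close> applicable; with
      \<open>\<theta> * d / 2 = \<theta> * c - 1\<close> the \<open>u\<close> terms assemble into
      the quadratic form of \<open>prox_quadratic_bound\<close>.\<close>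
    have "\<theta> * (\<theta> * (norm (s + (d / 2) *\<^sub>R e))\<^sup>2 + d / 2 * (norm u)\<^sup>2)
        = (norm (\<theta> *\<^sub>R (s + (d / 2) *\<^sub>R e)))\<^sup>2 + \<theta> * d / 2 * (norm u)\<^sup>2"
      unfolding norm_scaleR power_mult_distrib by (simp add: power2_eq_square distrib_left mult.assoc)
    also have "\<dots> = (norm (u - \<theta> *\<^sub>R z))\<^sup>2 + (\<theta> * c - 1) * (norm u)\<^sup>2"
      unfolding q by (simp add: \<theta>c)
    also have "\<dots> = \<theta> * (\<theta> * (norm z)\<^sup>2 - (2 * inner z u - c * (norm u)\<^sup>2))"
      unfolding power2_norm_eq_inner
      by (simp add: inner_diff_left inner_diff_right inner_commute algebra_simps)
    finally have "\<theta> * (norm (s + (d / 2) *\<^sub>R e))\<^sup>2 + d / 2 * (norm u)\<^sup>2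
        = \<theta> * (norm z)\<^sup>2 - (2 * inner z u - c * (norm u)\<^sup>2)"
      using \<theta> by (simp only: mult_cancel_left) simp
    moreover have "\<alpha> * \<nu>\<^sub>g * (norm z)\<^sup>2 \<le> 2 * inner z u - c * (norm u)\<^sup>2"
      unfolding z_def u_def \<nu>\<^sub>g_def c_def k_def
      using g h \<alpha> k2 by (intro prox_quadratic_bound) auto
    ultimately show "\<theta> * (norm (s + (d / 2) *\<^sub>R e))\<^sup>2 + d / 2 * (norm u)\<^sup>2 \<le> (\<theta> - \<alpha> * \<nu>\<^sub>g) * (norm z)\<^sup>2"
      by (simp add: left_diff_distrib)
  qed
  finally have "(norm (R x - R y))\<^sup>2 \<le> (\<theta> - \<alpha> * \<nu>\<^sub>f) * (\<theta> - \<alpha> * \<nu>\<^sub>g) * (norm z)\<^sup>2"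
    by (simp add: mult.assoc)
  then have "norm (R x - R y) \<le> sqrt ((\<theta> - \<alpha> * \<nu>\<^sub>f) * (\<theta> - \<alpha> * \<nu>\<^sub>g) * (norm z)\<^sup>2)"
    by (rule real_le_rsqrt)
  then show "norm (R x - R y) \<le> sqrt ((\<theta> - \<alpha> * \<nu>\<^sub>f) * (\<theta> - \<alpha> * \<nu>\<^sub>g)) * norm (x - y)"
    by (simp add: real_sqrt_mult z_def)
qed

theorem theorem2:
  fixes f g h :: "'a::{real_inner, complete_space} \<Rightarrow> ereal"
    and \<mu>\<^sub>f \<mu>\<^sub>g \<mu>\<^sub>h L\<^sub>h \<alpha> lam \<nu>\<^sub>f \<nu>\<^sub>g \<theta> \<rho> :: real
    and L\<^sub>f L\<^sub>g :: ereal
  assumes "0 \<le> \<mu>\<^sub>f" "ereal \<mu>\<^sub>f < L\<^sub>f"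
    and "0 \<le> \<mu>\<^sub>g" "ereal \<mu>\<^sub>g < L\<^sub>g"
    and "0 \<le> \<mu>\<^sub>h" "\<mu>\<^sub>h < L\<^sub>h"
    and "f \<in> function_class \<mu>\<^sub>f L\<^sub>f"
    and "g \<in> function_class \<mu>\<^sub>g L\<^sub>g"
    and "h \<in> function_class \<mu>\<^sub>h (ereal L\<^sub>h)"
    and "lam > 0" "\<alpha> > 0"
    and "lam < 2 - \<alpha> * (\<mu>\<^sub>h + L\<^sub>h) / 2"
    and "\<nu>\<^sub>f = dys_nu \<alpha> \<mu>\<^sub>f L\<^sub>f \<mu>\<^sub>h"
    and "\<nu>\<^sub>g = dys_nu \<alpha> \<mu>\<^sub>g L\<^sub>g \<mu>\<^sub>h"
    and "\<theta> = 2 / (4 - \<alpha> * (\<mu>\<^sub>h + L\<^sub>h))"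
    and "\<rho> = 1 - lam * \<theta> + lam * sqrt ((\<theta> - \<alpha> * \<nu>\<^sub>f) * (\<theta> - \<alpha> * \<nu>\<^sub>g))"
  shows "\<rho>-lipschitz_on UNIV (dys_operator f g h \<alpha> lam)"
proof -
  define R where "R x = \<theta> *\<^sub>R x - prox \<alpha> g x
      + prox \<alpha> f (2 *\<^sub>R prox \<alpha> g x - x - \<alpha> *\<^sub>R grad h (prox \<alpha> g x))" for x
  define \<sigma> where "\<sigma> = sqrt ((\<theta> - \<alpha> * \<nu>\<^sub>f) * (\<theta> - \<alpha> * \<nu>\<^sub>g))"
  have gap: "\<alpha> * (\<mu>\<^sub>h + L\<^sub>h) < 4"
    using assms by linarith
  note core = dys_core_bound[OF assms(7,1,2) assms(8,3,4) assms(9,5,6) assms(11) gap,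
      folded assms(13,14,15)]
  have \<sigma>: "0 \<le> \<sigma>"
    unfolding \<sigma>_def using core(1) by simp
  have Rxy: "norm (R x - R y) \<le> \<sigma> * norm (x - y)" for x y
    using core(2) by (simp only: R_def \<sigma>_def)
  \<comment> \<open>The step size condition says exactly that \<open>lam\<close> is below
    \<open>1 / \<theta>\<close>, so both coefficients in \<open>T\<close> are nonnegative and the
    triangle inequality yields \<rho>.\<close>
  have lam: "0 \<le> 1 - lam * \<theta>"
    using assms(12) gap by (simp add: assms(15) field_simps)
  have T: "dys_operator f g h \<alpha> lam x = (1 - lam * \<theta>) *\<^sub>R x + lam *\<^sub>R R x" for x
    by (simp add: dys_operator_def R_def algebra_simps)
  show ?thesis
  proof (rule lipschitz_onI)
    fix x y
    have "dist (dys_operator f g h \<alpha> lam x) (dys_operator f g h \<alpha> lam y)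
        = norm ((1 - lam * \<theta>) *\<^sub>R (x - y) + lam *\<^sub>R (R x - R y))"
      by (simp add: dist_norm T algebra_simps)
    also have "\<dots> \<le> norm ((1 - lam * \<theta>) *\<^sub>R (x - y)) + norm (lam *\<^sub>R (R x - R y))"
      by (rule norm_triangle_ineq)
    also have "\<dots> = (1 - lam * \<theta>) * norm (x - y) + lam * norm (R x - R y)"
      using lam assms(10) by simp
    also have "\<dots> \<le> (1 - lam * \<theta>) * norm (x - y) + lam * (\<sigma> * norm (x - y))"
      using Rxy assms(10) by (intro add_left_mono mult_left_mono) auto
    also have "\<dots> = \<rho> * dist x y"
      by (simp add: assms(16) \<sigma>_def dist_norm algebra_simps)
    finally show "dist (dys_operator f g h \<alpha> lam x) (dys_operator f g h \<alpha> lam y) \<le> \<rho> * dist x y" .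
  next
    show "0 \<le> \<rho>"
      using lam \<sigma> assms(10) by (simp add: assms(16) flip: \<sigma>_def)
  qed
qed

end
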